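(* For all parameters $p\in(0,\infty]$, $q\in(0,\infty]$, $\alpha\in\mathbb{R}$, the Lorentz--Zygmund space $(\ell^{p,q;\alpha},\|\cdot\|_{p,q;\alpha})$ is a rearrangement-invariant quasi-Banach sequence space.
   Context: $\mathcal{M}$ is the set of all sequences $a=\{a_n\}_{n=1}^\infty$ with values in $[-\infty,\infty]$; $m$ is the counting measure on $\mathbb{N}=\{1,2,\dots\}$. For $a\in\mathcal{M}$ the distribution function is $a_*(\lambda)=m(\{k:|a_k|>\lambda\})$, $\lambda\ge0$, and the non-increasing rearrangement is $a_n^*=\inf\{\lambda\in[0,\infty): a_*(\lambda)\le n-1\}$ ($\inf\emptyset=\infty$). Conventions: $1/\infty=0$, $0\cdot\infty=0$. $\|a\|_q=(\sum_n|a_n|^q)^{1/q}$ for $0<q<\infty$ and $\|a\|_\infty=\sup_n|a_n|$. $\|a\|_{p,q;\alpha}=\big\|\{a_n^*\,n^{\frac1p-\frac1q}(1+\log n)^\alpha\}_n\big\|_q$ and $\ell^{p,q;\alpha}=\{a\in\mathcal{M}:\|a\|_{p,q;\alpha}<\infty\}$. For a functional $\|\cdot\|_X:\mathcal{M}\to[0,\infty]$, the space $X=\{a\in\mathcal{M}:\|a\|_X<\infty\}$ is a quasi-Banach sequence space if: (Q1) $\|a\|_X=0$ iff $a=0$; $\|ca\|_X=|c|\,\|a\|_X$ for every $c\in\mathbb{R}$; there is a constant $C>0$ with $\|a+b\|_X\le C(\|a\|_X+\|b\|_X)$ for all $a,b\in\mathcal{M}$ (for which $a+b$ is defined); and $\|a\|_X=\||a|\|_X$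 for all $a\in\mathcal{M}$; (P2) $0\le a\le b$ (pointwise) implies $\|a\|_X\le\|b\|_X$; (P3) if $0\le a^n\nearrow a$ pointwise, then $\|a^n\|_X\nearrow\|a\|_X$; (P4) $\|\chi_E\|_X<\infty$ whenever $E\subset\mathbb{N}$, $m(E)<\infty$ ($\chi_E$ being the characteristic sequence of $E$); (P5) if $m(E)<\infty$, there is a constant $C_E$ such that $\sum_{n\in E}|a_n|\le C_E\|a\|_X$ for all $a\in X$. It is rearrangement-invariant if $\|a\|_X=\|b\|_X$ whenever $a,b\in\mathcal{M}$ and $a_*=b_*$. *)

theory Defs
  imports "HOL-Analysis.Analysis"
begin

text \<open>
  Sequences are indexed by \<open>\<nat> = {1, 2, \<dots>}\<close> in the mathematics and by \<open>nat\<close> here: \<open>a k\<close> is the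
  term \<open>a\<^sub>k\<^sub>+\<^sub>1\<close>. The set of all sequences with values in \<open>[-\<infinity>, \<infinity>]\<close> is then the whole type.
\<close>

type_synonym eseq = "nat \<Rightarrow> ereal"

abbreviation counting :: "nat measure" where
  "counting \<equiv> count_space UNIV"

definition distribution_fun :: "eseq \<Rightarrow> real \<Rightarrow> ennreal" where
  "distribution_fun a t = emeasure counting {k. \<bar>a k\<bar> > ereal t}"

text \<open>The bound is \<open>n\<close> rather than \<open>n - 1\<close> because of the index shift; \<open>Inf {} = \<infinity>\<close> in \<open>ereal\<close>.\<close>

definition rearrangement :: "eseq \<Rightarrow> eseq" where
  "rearrangement a n = Inf {ereal t | t. 0 \<le> t \<and> distribution_fun a t \<le> of_nat n}"

text \<open>Power of an element of \<open>[0, \<infinity>]\<close>, meant for exponents \<open>r > 0\<close>.\<close>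

definition ennpowr :: "ennreal \<Rightarrow> real \<Rightarrow> ennreal" where
  "ennpowr x r = (if x = \<infinity> then \<infinity> else ennreal (enn2real x powr r))"

definition lq_norm :: "ennreal \<Rightarrow> eseq \<Rightarrow> ennreal" where
  "lq_norm q a =
     (if q = \<infinity> then (SUP n. e2ennreal \<bar>a n\<bar>)
      else ennpowr (\<Sum>n. ennpowr (e2ennreal \<bar>a n\<bar>) (enn2real q)) (1 / enn2real q))"

text \<open>
  In \<open>ennreal\<close>, \<open>1 / \<infinity> = 0\<close>, so the exponents \<open>1/p\<close> and \<open>1/q\<close> are the intended real numbers
  for all \<open>p, q \<in> (0, \<infinity>]\<close>. The logarithm is the natural one.
\<close>

definition lz_weight :: "ennreal \<Rightarrow> ennreal \<Rightarrow> real \<Rightarrow> nat \<Rightarrow> real" where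
  "lz_weight p q \<alpha> n =
     real (Suc n) powr (enn2real (1 / p) - enn2real (1 / q)) * (1 + ln (real (Suc n))) powr \<alpha>"

definition lz_norm :: "ennreal \<Rightarrow> ennreal \<Rightarrow> real \<Rightarrow> eseq \<Rightarrow> ennreal" where
  "lz_norm p q \<alpha> a = lq_norm q (\<lambda>n. rearrangement a n * ereal (lz_weight p q \<alpha> n))"

definition lz_space :: "ennreal \<Rightarrow> ennreal \<Rightarrow> real \<Rightarrow> eseq set" where
  "lz_space p q \<alpha> = {a. lz_norm p q \<alpha> a < \<infinity>}"

text \<open>\<open>ereal\<close> addition is total (\<open>\<infinity> + -\<infinity> = \<infinity>\<close>), so definedness of \<open>a + b\<close> is made explicit.\<close>

definition sum_defined :: "eseq \<Rightarrow> eseq \<Rightarrow> bool" where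
  "sum_defined a b \<longleftrightarrow>
     (\<forall>k. \<not> (a k = \<infinity> \<and> b k = - \<infinity>) \<and> \<not> (a k = - \<infinity> \<and> b k = \<infinity>))"

locale quasi_banach_sequence_space =
  fixes X :: "eseq set" and N :: "eseq \<Rightarrow> ennreal"
  assumes space_eq: "X = {a. N a < \<infinity>}"
    and Q1_zero: "\<And>a. N a = 0 \<longleftrightarrow> (\<forall>k. a k = 0)"
    and Q1_scale: "\<And>(c :: real) a. N (\<lambda>k. ereal c * a k) = ennreal \<bar>c\<bar> * N a"
    and Q1_triangle:
      "\<exists>C :: real. C > 0 \<and>
         (\<forall>a b. sum_defined a b \<longrightarrow> N (\<lambda>k. a k + b k) \<le> ennreal C * (N a + N b))"
    and Q1_abs: "\<And>a. N a = N (\<lambda>k. \<bar>a k\<bar>)"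
    and P2: "\<And>a b. (\<forall>k. 0 \<le> a k \<and> a k \<le> b k) \<Longrightarrow> N a \<le> N b"
    and P3:
      "\<And>(s :: nat \<Rightarrow> eseq) a.
         (\<forall>k. (\<forall>i. 0 \<le> s i k) \<and> incseq (\<lambda>i. s i k) \<and> (\<lambda>i. s i k) \<longlonglongrightarrow> a k) \<Longrightarrow>
         incseq (\<lambda>i. N (s i)) \<and> (\<lambda>i. N (s i)) \<longlonglongrightarrow> N a"
    and P4: "\<And>E. emeasure counting E < \<infinity> \<Longrightarrow> N (indicator E) < \<infinity>"
    and P5:
      "\<And>E. emeasure counting E < \<infinity> \<Longrightarrow>
         \<exists>C :: real. C \<ge> 0 \<and> (\<forall>a\<in>X. (\<Sum>n\<in>E. e2ennreal \<bar>a n\<bar>) \<le> ennreal C * N a)"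

locale ri_quasi_banach_sequence_space = quasi_banach_sequence_space +
  assumes rearrangement_invariant:
    "\<And>a b. (\<forall>t\<ge>0. distribution_fun a t = distribution_fun b t) \<Longrightarrow> N a = N b"

end

theory Submission
  imports Defs
begin

text \<open>
  Indices start at \<open>0\<close>. Everything rests on the Galois-type relation \<open>t < a\<^sup>*\<^sub>n \<longleftrightarrow> n < a\<^sub>*(t)\<close>, which holds because
  \<open>a\<^sub>*\<close> is right continuous. It transfers monotonicity, homogeneity and monotone convergence from
  the distribution function to the rearrangement, and it turns
  \<open>(a + b)\<^sub>*(s + t) \<le> a\<^sub>*(s) + b\<^sub>*(t)\<close> into \<open>(a + b)\<^sup>*\<^sub>m\<^sub>+\<^sub>n \<le> a\<^sup>*\<^sub>m + b\<^sup>*\<^sub>n\<close>. The quasi-triangle inequality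
  follows by taking \<open>m = n = \<lfloor>k / 2\<rfloor>\<close>, since the weight at \<open>k\<close> is comparable to the weight at
  \<open>\<lfloor>k / 2\<rfloor>\<close>. The local integrability (P5) holds because the first weight is \<open>1\<close>,
  whence \<open>\<bar>a\<^sub>k\<bar> \<le> a\<^sup>*\<^sub>0 \<le> \<parallel>a\<parallel>\<close>.
\<close>

section \<open>Powers in the extended half-line\<close>

lemma ennpowr_ennreal [simp]: "0 \<le> x \<Longrightarrow> ennpowr (ennreal x) r = ennreal (x powr r)"
  by (simp add: ennpowr_def)

lemma ennpowr_top [simp]: "ennpowr top r = top"
  by (simp add: ennpowr_def)

lemma ennpowr_0 [simp]: "ennpowr 0 r = 0"
  by (simp add: ennpowr_def)

lemma ennpowr_mono:
  assumes "x \<le> y" "0 < r"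
  shows "ennpowr x r \<le> ennpowr y r"
  using assms
  by (cases x; cases y) (auto intro!: ennreal_leI powr_mono2 simp: top_unique)

lemma ennpowr_inverse:
  assumes "0 < r"
  shows "ennpowr (ennpowr x r) (1 / r) = x"
  using assms by (cases x) (auto simp: powr_powr)

lemma ennpowr_inverse':
  assumes "0 < r"
  shows "ennpowr (ennpowr x (1 / r)) r = x"
  using ennpowr_inverse[of "1 / r" x] assms by simp

text \<open>For \<open>0 < r\<close> the power is an order isomorphism of the extended half-line
  with inverse exponent \<open>1 / r\<close>. This adjunction form gives commutation with suprema
  below.\<close>

lemma ennpowr_le_iff:
  assumes "0 < r"
  shows "ennpowr x r \<le> y \<longleftrightarrow> x \<le> ennpowr y (1 / r)"
  by (metis assms ennpowr_inverse ennpowr_inverse' ennpowr_mono zero_less_divide_1_iff)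

lemma ennpowr_mult:
  assumes "0 < r"
  shows "ennpowr (x * y) r = ennpowr x r * ennpowr y r"
\<comment> \<open>Zero factors are split off because of 0 * \<infinity> = 0; otherwise an infinite
  factor makes both sides infinite.\<close>
proof (cases "x = 0 \<or> y = 0")
  case False
  then show ?thesis
    using assms
    by (cases x; cases y)
      (auto simp: ennreal_mult[symmetric] powr_mult ennreal_mult_top ennreal_top_mult)
qed auto

lemma ennpowr_SUP:
  assumes "0 < r"
  shows "ennpowr (SUP i. f i) r = (SUP i. ennpowr (f i) r)"
proof (rule antisym)
  show "ennpowr (SUP i. f i) r \<le> (SUP i. ennpowr (f i) r)"
    unfolding ennpowr_le_iff[OF assms]
    by (rule SUP_least) (auto simp: ennpowr_le_iff[OF assms, symmetric] intro: SUP_upper)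
  show "(SUP i. ennpowr (f i) r) \<le> ennpowr (SUP i. f i) r"
    by (intro SUP_least ennpowr_mono SUP_upper assms) auto
qed

text \<open>Bounding the sum by twice the maximum covers concave and convex powers at once.\<close>

lemma ennpowr_add_le:
  assumes "0 < r"
  shows "ennpowr (x + y) r \<le> ennreal (2 powr r) * (ennpowr x r + ennpowr y r)"
proof -
  have "x + y \<le> 2 * max x y"
    unfolding mult_2 by (intro add_mono) auto
  then have "ennpowr (x + y) r \<le> ennpowr (2 * max x y) r"
    by (rule ennpowr_mono[OF _ assms])
  also have "\<dots> = ennreal (2 powr r) * ennpowr (max x y) r"
    using ennpowr_ennreal[of 2 r] by (simp add: ennpowr_mult[OF assms])
  also have "\<dots> \<le> ennreal (2 powr r) * (ennpowr x r + ennpowr y r)"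
    by (intro mult_left_mono) (auto simp: max_def)
  finally show ?thesis .
qed


section \<open>The \<open>\<ell>\<^sup>q\<close> functional on nonnegative sequences\<close>

text \<open>An \<open>ennreal\<close>-valued counterpart of \<open>lq_norm\<close>, free of signs
  and absolute values, so that sums and suprema always behave well.\<close>

definition lq_enn :: "ennreal \<Rightarrow> (nat \<Rightarrow> ennreal) \<Rightarrow> ennreal" where
  "lq_enn q f =
     (if q = \<infinity> then (SUP n. f n)
      else ennpowr (\<Sum>n. ennpowr (f n) (enn2real q)) (1 / enn2real q))"

lemma lq_norm_eq_lq_enn: "lq_norm q a = lq_enn q (\<lambda>n. e2ennreal \<bar>a n\<bar>)"
  by (simp add: lq_norm_def lq_enn_def)

lemma enn2real_pos: "0 < q \<Longrightarrow> q \<noteq> top \<Longrightarrow> 0 < enn2real q"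
  by (simp add: enn2real_positive_iff top.not_eq_extremum)

lemma lq_enn_mono:
  assumes "0 < q" "\<And>n. f n \<le> g n"
  shows "lq_enn q f \<le> lq_enn q g"
  using assms enn2real_pos[of q]
  by (auto simp: lq_enn_def intro!: SUP_mono' ennpowr_mono suminf_le)

lemma lq_enn_cmult:
  assumes "0 < q"
  shows "lq_enn q (\<lambda>n. c * f n) = c * lq_enn q f"
proof (cases "q = \<infinity>")
  case True
  then show ?thesis
    by (simp add: lq_enn_def SUP_mult_left_ennreal)
next
  case False
  then have r: "0 < enn2real q"
    using assms enn2real_pos by simp
  then show ?thesis
    using False by (simp add: lq_enn_def ennpowr_mult ennpowr_inverse)
qed

lemma lq_enn_ge:
  assumes "0 < q"
  shows "f n \<le> lq_enn q f"
proof (cases "q = \<infinity>")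
  case True
  then show ?thesis
    by (simp add: lq_enn_def SUP_upper)
next
  case False
  then have r: "0 < enn2real q"
    using assms enn2real_pos by simp
  have "ennpowr (f n) (enn2real q) \<le> (\<Sum>n. ennpowr (f n) (enn2real q))"
    using sum_le_suminf[of "\<lambda>n. ennpowr (f n) (enn2real q)" "{n}"] by simp
  then show ?thesis
    using False r by (simp add: lq_enn_def ennpowr_le_iff)
qed

text \<open>Monotone convergence: for finite \<open>q\<close> both the powers and the series pass
  through increasing suprema; for infinite \<open>q\<close> two suprema are interchanged.\<close>

lemma lq_enn_SUP:
  assumes "0 < q" "incseq f"
  shows "lq_enn q (\<lambda>n. SUP i. f i n) = (SUP i. lq_enn q (f i))"
proof (cases "q = \<infinity>")
  case True
  then show ?thesis
    using SUP_commute[of "\<lambda>n i. f i n" UNIV UNIV] by (simp add: lq_enn_def)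
next
  case False
  then have r: "0 < enn2real q"
    using assms enn2real_pos by simp
  have "(\<Sum>n. SUP i. ennpowr (f i n) (enn2real q)) = (SUP i. \<Sum>n. ennpowr (f i n) (enn2real q))"
    using assms(2) r
    by (intro ennreal_suminf_SUP_eq) (auto simp: incseq_def le_fun_def intro!: ennpowr_mono)
  then show ?thesis
    using False r by (simp add: lq_enn_def ennpowr_SUP)
qed

lemma lq_enn_add_le:
  assumes "0 < q"
  shows "\<exists>C>0. \<forall>f g. lq_enn q (\<lambda>n. f n + g n) \<le> ennreal C * (lq_enn q f + lq_enn q g)"
proof (cases "q = \<infinity>")
  case True
  have "(SUP n. f n + g n) \<le> (SUP n. f n) + (SUP n. g n)" for f g :: "nat \<Rightarrow> ennreal"
    by (intro SUP_least add_mono SUP_upper) auto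
  then show ?thesis
    using True by (intro exI[of _ 1]) (simp add: lq_enn_def)
next
  case False
  define r where "r = enn2real q"
  have r: "0 < r"
    using assms enn2real_pos False by (simp add: r_def)
  have "lq_enn q (\<lambda>n. f n + g n) \<le> ennreal (2 * 2 powr (1 / r)) * (lq_enn q f + lq_enn q g)" for f g
  proof -
    let ?F = "\<Sum>n. ennpowr (f n) r" and ?G = "\<Sum>n. ennpowr (g n) r"
    have "(\<Sum>n. ennpowr (f n + g n) r)
        \<le> (\<Sum>n. ennreal (2 powr r) * (ennpowr (f n) r + ennpowr (g n) r))"
      by (intro suminf_le ennpowr_add_le r) auto
    also have "\<dots> = ennreal (2 powr r) * (?F + ?G)"
      by (simp add: suminf_add)
    finally have "lq_enn q (\<lambda>n. f n + g n) \<le> ennpowr (ennreal (2 powr r) * (?F + ?G)) (1 / r)"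
      using r False by (simp add: lq_enn_def r_def[symmetric] ennpowr_mono)
    \<comment> \<open>The outer root turns \<open>2 powr r\<close> into 2. Splitting the remaining
      sum under the exponent \<open>1 / r\<close> costs the second factor
      \<open>2 powr (1 / r)\<close>.\<close>
    also have "\<dots> = 2 * ennpowr (?F + ?G) (1 / r)"
      using r by (simp add: ennpowr_mult powr_powr)
    also have "\<dots> \<le> 2 * (ennreal (2 powr (1 / r)) * (ennpowr ?F (1 / r) + ennpowr ?G (1 / r)))"
      using r by (intro mult_left_mono ennpowr_add_le) auto
    also have "\<dots> = ennreal (2 * 2 powr (1 / r)) * (lq_enn q f + lq_enn q g)"
      using False by (simp add: lq_enn_def r_def[symmetric] ennreal_mult mult.assoc)
    finally show ?thesis .
  qed
  then show ?thesis
    by (intro exI[of _ "2 * 2 powr (1 / r)"]) auto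
qed

text \<open>Each index \<open>j\<close> equals \<open>k div 2\<close> for exactly two values of
  \<open>k\<close>, namely \<open>2 * j\<close> and \<open>2 * j + 1\<close>.\<close>

lemma suminf_div2_le:
  fixes f :: "nat \<Rightarrow> ennreal"
  shows "(\<Sum>k. f (k div 2)) \<le> 2 * (\<Sum>k. f k)"
  unfolding suminf_eq_SUP[of "\<lambda>k. f (k div 2)"]
proof (rule SUP_least)
  fix N :: nat
  \<comment> \<open>An even number of terms makes all pairs complete.\<close>
  have "(\<Sum>k<N. f (k div 2)) \<le> (\<Sum>k<2 * N. f (k div 2))"
    by (intro sum_mono2) auto
  also have "\<dots> = 2 * (\<Sum>k<N. f k)"
    by (induction N) (simp_all add: distrib_left add.assoc mult_2)
  also have "\<dots> \<le> 2 * (\<Sum>k. f k)"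
    by (intro mult_left_mono sum_le_suminf) auto
  finally show "(\<Sum>k<N. f (k div 2)) \<le> 2 * (\<Sum>k. f k)" .
qed

text \<open>Boundedness of the dilation that repeats every term twice; it absorbs the halved index
  that arises when a sum is rearranged.\<close>

lemma lq_enn_div2_le:
  assumes "0 < q"
  shows "\<exists>C>0. \<forall>f. lq_enn q (\<lambda>k. f (k div 2)) \<le> ennreal C * lq_enn q f"
proof (cases "q = \<infinity>")
  case True
  have "(SUP k. f (k div 2)) \<le> (SUP k. f k)" for f :: "nat \<Rightarrow> ennreal"
    by (intro SUP_least SUP_upper) auto
  then show ?thesis
    using True by (intro exI[of _ 1]) (simp add: lq_enn_def)
next
  case False
  define r where "r = enn2real q"
  have r: "0 < r"
    using assms enn2real_pos False by (simp add: r_def)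
  have "lq_enn q (\<lambda>k. f (k div 2)) \<le> ennreal (2 powr (1 / r)) * lq_enn q f" for f
  proof -
    have "lq_enn q (\<lambda>k. f (k div 2)) \<le> ennpowr (2 * (\<Sum>k. ennpowr (f k) r)) (1 / r)"
      using False r suminf_div2_le[of "\<lambda>k. ennpowr (f k) r"]
      by (simp add: lq_enn_def r_def[symmetric] ennpowr_mono)
    also have "\<dots> = ennreal (2 powr (1 / r)) * lq_enn q f"
      using False r ennpowr_ennreal[of 2 "1 / r"]
      by (simp add: lq_enn_def r_def[symmetric] ennpowr_mult)
    finally show ?thesis .
  qed
  then show ?thesis
    by (intro exI[of _ "2 powr (1 / r)"]) auto
qed

lemma lq_enn_finite_support:
  assumes "0 < q" "\<And>n. f n < \<infinity>" "\<And>n. N \<le> n \<Longrightarrow> f n = 0"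
  shows "lq_enn q f < \<infinity>"
proof (cases "q = \<infinity>")
  case True
  \<comment> \<open>The finite sum is a crude bound that also works for
    \<open>N = 0\<close>.\<close>
  have "(SUP n. f n) \<le> (\<Sum>n<N. f n)"
  proof (rule SUP_least)
    fix n
    show "f n \<le> (\<Sum>n<N. f n)"
      using assms(3)[of n] by (cases "n < N") (auto intro: member_le_sum)
  qed
  also have "\<dots> < \<infinity>"
    using assms(2) by simp
  finally show ?thesis
    using True by (simp add: lq_enn_def)
next
  case False
  have fin: "ennpowr x s < \<infinity>" if "x < \<infinity>" for x s
    using that by (simp add: ennpowr_def)
  have "(\<Sum>n. ennpowr (f n) (enn2real q)) = (\<Sum>n<N. ennpowr (f n) (enn2real q))"
    using assms(3) by (intro suminf_finite) auto
  also have "\<dots> < \<infinity>"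
    using assms(2) fin by simp
  finally show ?thesis
    using False fin by (simp add: lq_enn_def)
qed


section \<open>The rearrangement\<close>

text \<open>Nothing is lost by passing to \<open>ennreal\<close>, since the rearrangement is
  nonnegative.\<close>

definition enn_rearrangement :: "eseq \<Rightarrow> nat \<Rightarrow> ennreal" where
  "enn_rearrangement a n = e2ennreal (rearrangement a n)"

lemma rearrangement_nonneg: "0 \<le> rearrangement a n"
  unfolding rearrangement_def by (rule Inf_greatest) auto

section \<open>The distribution function and the Galois relation\<close>

lemma distribution_fun_antimono: "s \<le> t \<Longrightarrow> distribution_fun a t \<le> distribution_fun a s"
  unfolding distribution_fun_def
  by (intro emeasure_mono) (auto intro: le_less_trans[of "ereal s" "ereal t"])

lemma distribution_fun_mono:
  assumes "\<And>k. \<bar>a k\<bar> \<le> \<bar>b k\<bar>"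
  shows "distribution_fun a t \<le> distribution_fun b t"
  unfolding distribution_fun_def
  by (intro emeasure_mono) (auto intro: less_le_trans assms)

text \<open>The superlevel sets at the levels \<open>t + 1 / real (Suc i)\<close> increase to the
  one at \<open>t\<close>, and the counting measure is continuous from below.\<close>

lemma distribution_fun_right_continuous:
  "distribution_fun a t = (SUP i. distribution_fun a (t + 1 / real (Suc i)))"
proof -
  let ?A = "\<lambda>i. {k. \<bar>a k\<bar> > ereal (t + 1 / real (Suc i))}"
  have "incseq ?A"
  proof (rule incseq_SucI, safe)
    fix i k assume "ereal (t + 1 / real (Suc i)) < \<bar>a k\<bar>"
    moreover have "ereal (t + 1 / real (Suc (Suc i))) \<le> ereal (t + 1 / real (Suc i))"
      using frac_le[of 1 1 "real (Suc i)" "real (Suc (Suc i))"] by simp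
    ultimately show "ereal (t + 1 / real (Suc (Suc i))) < \<bar>a k\<bar>"
      by (rule le_less_trans[rotated])
  qed
  then have "(SUP i. emeasure counting (?A i)) = emeasure counting (\<Union>i. ?A i)"
    by (intro SUP_emeasure_incseq) auto
  moreover have "(\<Union>i. ?A i) = {k. \<bar>a k\<bar> > ereal t}"
  proof safe
    fix i k assume "ereal (t + 1 / real (Suc i)) < \<bar>a k\<bar>"
    moreover have "ereal t \<le> ereal (t + 1 / real (Suc i))"
      by simp
    ultimately show "ereal t < \<bar>a k\<bar>"
      by (rule le_less_trans[rotated])
  next
    fix k assume "ereal t < \<bar>a k\<bar>"
    then obtain s where s: "ereal t < ereal s" "ereal s < \<bar>a k\<bar>"
      using ereal_dense2 by blast
    then obtain i where "1 / real (Suc i) < s - t"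
      using nat_approx_posE[of "s - t"] by auto
    then have "ereal (t + 1 / real (Suc i)) < ereal s"
      by simp
    then show "k \<in> (\<Union>i. ?A i)"
      using s(2) by (blast intro: less_trans)
  qed
  ultimately show ?thesis
    by (simp add: distribution_fun_def)
qed

lemma less_enn_rearrangement_iff:
  assumes "0 \<le> t"
  shows "ennreal t < enn_rearrangement a n \<longleftrightarrow> of_nat n < distribution_fun a t"
proof -
  have "ereal t < rearrangement a n \<longleftrightarrow> of_nat n < distribution_fun a t"
  proof
    assume less: "ereal t < rearrangement a n"
    show "of_nat n < distribution_fun a t"
    proof (rule ccontr)
      assume "\<not> ?thesis"
      then have "rearrangement a n \<le> ereal t"
        unfolding rearrangement_def using assms by (intro Inf_lower) (auto simp: not_less)
      then show False
        using less by simp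
    qed
  next
    assume "of_nat n < distribution_fun a t"
    \<comment> \<open>Right continuity leaves room above \<open>t\<close>: the inequality persists
      at a larger level, which is a lower bound for all admissible \<open>s\<close>. Hence the
      infimum stays strictly above \<open>t\<close>.\<close>
    then obtain i where i: "of_nat n < distribution_fun a (t + 1 / real (Suc i))"
      unfolding distribution_fun_right_continuous[of a t] less_SUP_iff by auto
    have "ereal (t + 1 / real (Suc i)) \<le> rearrangement a n"
      unfolding rearrangement_def
    proof (rule Inf_greatest, safe)
      fix s assume "distribution_fun a s \<le> of_nat n"
      then have "\<not> s \<le> t + 1 / real (Suc i)"
        using i distribution_fun_antimono[of s "t + 1 / real (Suc i)" a] by auto
      then show "ereal (t + 1 / real (Suc i)) \<le> ereal s"
        by simp
    qed
    moreover have "ereal t < ereal (t + 1 / real (Suc i))"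
      by simp
    ultimately show "ereal t < rearrangement a n"
      by (rule less_le_trans[rotated])
  qed
  moreover have "ennreal t < enn_rearrangement a n \<longleftrightarrow> ereal t < rearrangement a n"
    unfolding enn_rearrangement_def
    using assms rearrangement_nonneg[of a n]
    by (cases "rearrangement a n") (auto simp: ennreal_less_iff)
  ultimately show ?thesis
    by simp
qed

lemma enn_rearrangement_le_iff:
  assumes "0 \<le> t"
  shows "enn_rearrangement a n \<le> ennreal t \<longleftrightarrow> distribution_fun a t \<le> of_nat n"
  using less_enn_rearrangement_iff[OF assms, of a n] by (simp add: not_less[symmetric])

text \<open>By density of the order it suffices to test finite levels, which are those covered by
  the Galois relation.\<close>

lemma ennreal_le_by_reals:
  fixes x y :: ennreal
  assumes "\<And>t. 0 \<le> t \<Longrightarrow> ennreal t < x \<Longrightarrow> ennreal t < y"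
  shows "x \<le> y"
proof (rule ccontr)
  assume "\<not> x \<le> y"
  then obtain z where z: "y < z" "z < x"
    using dense[of y x] by (auto simp: not_le)
  then obtain t where "z = ennreal t" "0 \<le> t"
    by (cases z) auto
  then show False
    using assms[of t] z by auto
qed

section \<open>Order, scaling, sums and limits under rearrangement\<close>

lemma enn_rearrangement_mono:
  assumes "\<And>k. \<bar>a k\<bar> \<le> \<bar>b k\<bar>"
  shows "enn_rearrangement a n \<le> enn_rearrangement b n"
  by (rule ennreal_le_by_reals)
    (auto simp: less_enn_rearrangement_iff intro: less_le_trans distribution_fun_mono assms)

lemma enn_rearrangement_antimono:
  assumes "m \<le> n"
  shows "enn_rearrangement a n \<le> enn_rearrangement a m"
proof (rule ennreal_le_by_reals)
  fix t :: real assume "0 \<le> t" "ennreal t < enn_rearrangement a n"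
  moreover have "of_nat m \<le> (of_nat n :: ennreal)"
    using assms by simp
  ultimately show "ennreal t < enn_rearrangement a m"
    by (auto simp: less_enn_rearrangement_iff simp del: of_nat_le_iff intro: le_less_trans)
qed

lemma enn_rearrangement_cmult:
  fixes c :: real
  shows "enn_rearrangement (\<lambda>k. ereal c * a k) n = ennreal \<bar>c\<bar> * enn_rearrangement a n"
\<comment> \<open>Scaling by \<open>c\<close> replaces the level \<open>t\<close> by
  \<open>t / \<bar>c\<bar>\<close>, so \<open>c = 0\<close> is treated apart: there the level 0 is
  already admissible for every \<open>n\<close>.\<close>
proof (cases "c = 0")
  case True
  have "distribution_fun (\<lambda>k. 0) 0 = 0"
    by (simp add: distribution_fun_def)
  then have "enn_rearrangement (\<lambda>k. 0) n \<le> ennreal 0"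
    by (subst enn_rearrangement_le_iff) auto
  then show ?thesis
    using True by (simp add: zero_ereal_def[symmetric])
next
  case False
  have dist: "distribution_fun (\<lambda>k. ereal c * a k) t = distribution_fun a (t / \<bar>c\<bar>)" for t
  proof -
    have "ereal t < \<bar>ereal c * a k\<bar> \<longleftrightarrow> ereal (t / \<bar>c\<bar>) < \<bar>a k\<bar>" for k
      using False by (cases "a k") (auto simp: abs_mult divide_simps mult.commute)
    then show ?thesis
      by (simp add: distribution_fun_def)
  qed
  have "ennreal t < enn_rearrangement (\<lambda>k. ereal c * a k) n
      \<longleftrightarrow> ennreal t < ennreal \<bar>c\<bar> * enn_rearrangement a n" if "0 \<le> t" for t
  proof -
    have "ennreal t < enn_rearrangement (\<lambda>k. ereal c * a k) n
        \<longleftrightarrow> ennreal (t / \<bar>c\<bar>) < enn_rearrangement a n"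
      using that by (simp add: less_enn_rearrangement_iff dist)
    also have "\<dots> \<longleftrightarrow> ennreal t < ennreal \<bar>c\<bar> * enn_rearrangement a n"
      using that False
      by (cases "enn_rearrangement a n")
        (auto simp: ennreal_less_iff ennreal_mult[symmetric] ennreal_mult_top divide_simps mult.commute)
    finally show ?thesis .
  qed
  then show ?thesis
    by (intro antisym ennreal_le_by_reals) auto
qed

text \<open>With \<open>s\<close> and \<open>t\<close> the two values on the right, a term of the
  sum exceeds \<open>s + t\<close> only if one summand exceeds its own level; at most
  \<open>m\<close> and \<open>n\<close> indices do so.\<close>

lemma enn_rearrangement_add:
  "enn_rearrangement (\<lambda>k. a k + b k) (m + n) \<le> enn_rearrangement a m + enn_rearrangement b n"
proof (cases "enn_rearrangement a m = top \<or> enn_rearrangement b n = top")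
  case False
  then obtain s t where s: "enn_rearrangement a m = ennreal s" "0 \<le> s"
    and t: "enn_rearrangement b n = ennreal t" "0 \<le> t"
    by (metis ennreal_cases)
  \<comment> \<open>The bounds force \<open>x\<close> and \<open>y\<close> to be finite, so the
    convention for \<infinity> + -\<infinity> is never met.\<close>
  have "\<bar>x + y\<bar> \<le> ereal (s + t)" if "\<bar>x\<bar> \<le> ereal s" "\<bar>y\<bar> \<le> ereal t" for x y :: ereal
    using that by (cases x; cases y) auto
  then have "{k. \<bar>a k + b k\<bar> > ereal (s + t)} \<subseteq> {k. \<bar>a k\<bar> > ereal s} \<union> {k. \<bar>b k\<bar> > ereal t}"
    by (auto simp: not_less[symmetric])
  then have "distribution_fun (\<lambda>k. a k + b k) (s + t)
      \<le> emeasure counting ({k. \<bar>a k\<bar> > ereal s} \<union> {k. \<bar>b k\<bar> > ereal t})"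
    unfolding distribution_fun_def by (intro emeasure_mono) auto
  also have "\<dots> \<le> distribution_fun a s + distribution_fun b t"
    unfolding distribution_fun_def by (intro emeasure_subadditive) auto
  also have "\<dots> \<le> of_nat m + of_nat n"
    using s t by (intro add_mono) (auto simp: enn_rearrangement_le_iff[symmetric])
  finally show ?thesis
    using s t by (simp add: ennreal_plus[symmetric] enn_rearrangement_le_iff del: ennreal_plus)
qed auto

lemma enn_rearrangement_add_div2:
  "enn_rearrangement (\<lambda>k. a k + b k) k
    \<le> enn_rearrangement a (k div 2) + enn_rearrangement b (k div 2)"
  by (rule order_trans[OF enn_rearrangement_antimono enn_rearrangement_add]) simp

text \<open>A supremum exceeds \<open>t\<close> exactly when some member does, so the superlevel
  sets increase to that of the limit; continuity from below concludes.\<close>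

lemma distribution_fun_SUP:
  assumes nonneg: "\<And>i k. 0 \<le> s i k" and inc: "\<And>k. incseq (\<lambda>i. s i k)"
    and lim: "\<And>k. (\<lambda>i. s i k) \<longlonglongrightarrow> a k"
  shows "distribution_fun a t = (SUP i. distribution_fun (s i) t)"
proof -
  have a: "a k = (SUP i. s i k)" for k
    using LIMSEQ_unique[OF lim LIMSEQ_SUP[OF inc]] .
  then have "0 \<le> a k" for k
    using nonneg by (simp add: SUP_upper2)
  then have "{k. \<bar>a k\<bar> > ereal t} = (\<Union>i. {k. \<bar>s i k\<bar> > ereal t})"
    using nonneg by (auto simp: a less_SUP_iff abs_of_nonneg)
  moreover have "incseq (\<lambda>i. {k. \<bar>s i k\<bar> > ereal t})"
    using inc nonneg by (auto simp: incseq_def intro: less_le_trans)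
  ultimately show ?thesis
    unfolding distribution_fun_def by (simp add: SUP_emeasure_incseq)
qed

lemma enn_rearrangement_SUP:
  assumes "\<And>i k. 0 \<le> s i k" "\<And>k. incseq (\<lambda>i. s i k)" "\<And>k. (\<lambda>i. s i k) \<longlonglongrightarrow> a k"
  shows "enn_rearrangement a n = (SUP i. enn_rearrangement (s i) n)"
proof -
  have "ennreal t < enn_rearrangement a n \<longleftrightarrow> ennreal t < (SUP i. enn_rearrangement (s i) n)"
    if "0 \<le> t" for t
    using that distribution_fun_SUP[of s a t] assms
    by (simp add: less_enn_rearrangement_iff less_SUP_iff)
  then show ?thesis
    by (intro antisym ennreal_le_by_reals) auto
qed

text \<open>Any level below the term has \<open>k\<close> in its superlevel set, so the distribution
  function is positive there. Both (P5) and definiteness of the norm rest on this.\<close>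

lemma le_enn_rearrangement_0: "e2ennreal \<bar>a k\<bar> \<le> enn_rearrangement a 0"
proof (rule ennreal_le_by_reals)
  fix t :: real assume t: "0 \<le> t" "ennreal t < e2ennreal \<bar>a k\<bar>"
  then have "k \<in> {k. \<bar>a k\<bar> > ereal t}"
    by (cases "a k") (auto simp: ennreal_less_iff)
  then have "distribution_fun a t \<noteq> 0"
    unfolding distribution_fun_def by (subst emeasure_count_space_eq_0) auto
  then show "ennreal t < enn_rearrangement a 0"
    using t by (simp add: less_enn_rearrangement_iff zero_less_iff_neq_zero)
qed


section \<open>The weight and the norm\<close>

lemma powr_le_powr_abs_mult:
  fixes x y :: real
  assumes "0 < y" "y \<le> x" "x \<le> 2 * y"
  shows "x powr d \<le> 2 powr \<bar>d\<bar> * y powr d"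
proof -
  have "x powr d = (x / y) powr d * y powr d"
    using assms by (simp add: powr_divide)
  \<comment> \<open>Since \<open>x / y\<close> is at least 1, enlarging the exponent is allowed;
    this handles negative \<open>d\<close>.\<close>
  also have "(x / y) powr d \<le> (x / y) powr \<bar>d\<bar>"
    using assms by (intro powr_mono) auto
  also have "\<dots> \<le> 2 powr \<bar>d\<bar>"
    using assms by (intro powr_mono2) (auto simp: divide_simps)
  finally show ?thesis
    using assms by simp
qed

lemma lz_weight_pos: "0 < lz_weight p q \<alpha> n"
proof -
  have "0 \<le> ln (real (Suc n))"
    by simp
  then have "0 < 1 + ln (real (Suc n))"
    by linarith
  then show ?thesis
    unfolding lz_weight_def by simp
qed

lemma lz_weight_0 [simp]: "lz_weight p q \<alpha> 0 = 1"
  by (simp add: lz_weight_def)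

lemma lz_weight_le_div2:
  "\<exists>C>0. \<forall>k. lz_weight p q \<alpha> k \<le> C * lz_weight p q \<alpha> (k div 2)"
proof -
  define d where "d = enn2real (1 / p) - enn2real (1 / q)"
  have "lz_weight p q \<alpha> k \<le> (2 powr \<bar>d\<bar> * 2 powr \<bar>\<alpha>\<bar>) * lz_weight p q \<alpha> (k div 2)" for k
  proof -
    \<comment> \<open>The shift by one gives \<open>x \<le> 2 * y\<close> for odd \<open>k\<close>
      too, with equality there.\<close>
    define x y where "x = real (Suc k)" and "y = real (Suc (k div 2))"
    have xy: "1 \<le> y" "y \<le> x" "x \<le> 2 * y"
      by (auto simp: x_def y_def)
    have "ln x \<le> ln (2 * y)"
      using xy by simp
    also have "\<dots> = ln 2 + ln y"
      using xy by (simp add: ln_mult)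
    \<comment> \<open>As \<open>ln 2 \<le> 1\<close> and \<open>ln y \<ge> 0\<close>, the
      logarithmic factor at most doubles, so the same power estimate serves both factors of the
      weight.\<close>
    finally have "1 + ln x \<le> 2 * (1 + ln y)"
      using ln_le_minus_one[of 2] ln_ge_zero[OF xy(1)] by simp
    moreover have "1 + ln y \<le> 1 + ln x" "0 < 1 + ln y"
      using xy by (auto intro: add_pos_nonneg)
    ultimately have "x powr d * (1 + ln x) powr \<alpha>
        \<le> (2 powr \<bar>d\<bar> * y powr d) * (2 powr \<bar>\<alpha>\<bar> * (1 + ln y) powr \<alpha>)"
      using xy by (intro mult_mono powr_le_powr_abs_mult) auto
    then show ?thesis
      by (simp add: lz_weight_def d_def x_def y_def mult_ac)
  qed
  then show ?thesis
    by (intro exI[of _ "2 powr \<bar>d\<bar> * 2 powr \<bar>\<alpha>\<bar>"]) auto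
qed

lemma lz_norm_eq:
  "lz_norm p q \<alpha> a = lq_enn q (\<lambda>n. ennreal (lz_weight p q \<alpha> n) * enn_rearrangement a n)"
proof -
  \<comment> \<open>Positivity of \<open>w\<close> keeps an infinite \<open>x\<close> infinite on
    both sides.\<close>
  have "e2ennreal \<bar>x * ereal w\<bar> = ennreal w * e2ennreal x" if "0 \<le> x" "0 < w" for x w
    using that by (cases x) (auto simp: abs_mult ennreal_mult[symmetric] mult.commute ennreal_mult_top)
  note this[OF rearrangement_nonneg lz_weight_pos]
  then show ?thesis
    unfolding lz_norm_def lq_norm_eq_lq_enn enn_rearrangement_def by simp
qed

section \<open>The axioms for the Lorentz-Zygmund functional\<close>

lemma lz_norm_mono:
  assumes "0 < q" "\<And>k. \<bar>a k\<bar> \<le> \<bar>b k\<bar>"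
  shows "lz_norm p q \<alpha> a \<le> lz_norm p q \<alpha> b"
  unfolding lz_norm_eq
  by (intro lq_enn_mono mult_left_mono enn_rearrangement_mono assms) auto

lemma lz_norm_cmult:
  fixes c :: real
  assumes "0 < q"
  shows "lz_norm p q \<alpha> (\<lambda>k. ereal c * a k) = ennreal \<bar>c\<bar> * lz_norm p q \<alpha> a"
  unfolding lz_norm_eq lq_enn_cmult[OF assms, symmetric]
  by (simp add: enn_rearrangement_cmult mult.left_commute)

lemma e2ennreal_abs_le_lz_norm:
  assumes "0 < q"
  shows "e2ennreal \<bar>a k\<bar> \<le> lz_norm p q \<alpha> a"
proof -
  have "enn_rearrangement a 0 \<le> lz_norm p q \<alpha> a"
    using lq_enn_ge[OF assms, of "\<lambda>n. ennreal (lz_weight p q \<alpha> n) * enn_rearrangement a n" 0]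
    by (simp add: lz_norm_eq)
  then show ?thesis
    using le_enn_rearrangement_0 order_trans by blast
qed

lemma lz_norm_eq_0_iff:
  assumes "0 < q"
  shows "lz_norm p q \<alpha> a = 0 \<longleftrightarrow> (\<forall>k. a k = 0)"
proof
  assume "lz_norm p q \<alpha> a = 0"
  then have "e2ennreal \<bar>a k\<bar> = 0" for k
    using e2ennreal_abs_le_lz_norm[OF assms, of a k p \<alpha>] by simp
  moreover have "x = 0" if "e2ennreal \<bar>x\<bar> = 0" for x
    using that by (cases x) (auto simp: ennreal_eq_0_iff)
  ultimately have "a k = 0" for k
    by blast
  then show "\<forall>k. a k = 0" ..
next
  assume "\<forall>k. a k = 0"
  \<comment> \<open>Written as a zero multiple, the sequence has norm zero by homogeneity, since 0
    times any value is 0 in \<open>ennreal\<close>.\<close>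
  then have "a = (\<lambda>k. ereal 0 * 0)"
    by auto
  then show "lz_norm p q \<alpha> a = 0"
    using lz_norm_cmult[OF assms, of p \<alpha> 0 "\<lambda>k. 0"] by simp
qed

text \<open>Three losses multiply: \<open>A\<close> for moving the weight from \<open>k\<close> to
  \<open>k div 2\<close>, \<open>B\<close> for undoing the dilation, and \<open>C\<close> for the
  quasi-triangle inequality of the unweighted functional.\<close>

lemma lz_norm_triangle:
  assumes "0 < q"
  shows "\<exists>C>0. \<forall>a b. lz_norm p q \<alpha> (\<lambda>k. a k + b k) \<le> ennreal C * (lz_norm p q \<alpha> a + lz_norm p q \<alpha> b)"
proof -
  obtain A where A: "A > 0" "\<And>k. lz_weight p q \<alpha> k \<le> A * lz_weight p q \<alpha> (k div 2)"
    using lz_weight_le_div2 by blast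
  obtain B where B: "B > 0" "\<And>f. lq_enn q (\<lambda>k. f (k div 2)) \<le> ennreal B * lq_enn q f"
    using lq_enn_div2_le[OF assms] by blast
  obtain C where C: "C > 0"
    "\<And>f g. lq_enn q (\<lambda>n. f n + g n) \<le> ennreal C * (lq_enn q f + lq_enn q g)"
    using lq_enn_add_le[OF assms] by blast
  let ?w = "\<lambda>k. ennreal (lz_weight p q \<alpha> k)"
  let ?N = "lz_norm p q \<alpha>"
  have "?N (\<lambda>k. a k + b k) \<le> ennreal (A * B * C) * (?N a + ?N b)" for a b
  proof -
    define f g where "f = (\<lambda>n. ?w n * enn_rearrangement a n)"
      and "g = (\<lambda>n. ?w n * enn_rearrangement b n)"
    have "?w k * enn_rearrangement (\<lambda>k. a k + b k) k \<le> ennreal A * (f (k div 2) + g (k div 2))" for k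
    proof -
      have "?w k \<le> ennreal A * ?w (k div 2)"
        using A lz_weight_pos[of p q \<alpha> "k div 2"]
        by (simp add: ennreal_mult[symmetric] ennreal_leI)
      then have "?w k * enn_rearrangement (\<lambda>k. a k + b k) k
          \<le> (ennreal A * ?w (k div 2))
            * (enn_rearrangement a (k div 2) + enn_rearrangement b (k div 2))"
        by (intro mult_mono enn_rearrangement_add_div2) auto
      then show ?thesis
        by (simp add: f_def g_def distrib_left mult.assoc)
    qed
    then have "?N (\<lambda>k. a k + b k) \<le> lq_enn q (\<lambda>k. ennreal A * (f (k div 2) + g (k div 2)))"
      unfolding lz_norm_eq by (rule lq_enn_mono[OF assms])
    also have "\<dots> = ennreal A * lq_enn q (\<lambda>k. f (k div 2) + g (k div 2))"
      by (rule lq_enn_cmult[OF assms])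
    also have "\<dots> \<le> ennreal A * (ennreal B * lq_enn q (\<lambda>k. f k + g k))"
      by (intro mult_left_mono B(2)) auto
    also have "\<dots> \<le> ennreal A * (ennreal B * (ennreal C * (lq_enn q f + lq_enn q g)))"
      by (intro mult_left_mono C(2)) auto
    also have "\<dots> = ennreal (A * B * C) * (?N a + ?N b)"
      using A(1) B(1) C(1) by (simp add: lz_norm_eq f_def g_def ennreal_mult mult.assoc)
    finally show ?thesis .
  qed
  then show ?thesis
    using A(1) B(1) C(1) by (intro exI[of _ "A * B * C"]) auto
qed

text \<open>Rearranging, multiplying by the weight and \<open>lq_enn\<close> each commute with
  increasing suprema.\<close>

lemma lz_norm_monotone_convergence:
  assumes q: "0 < q" and s: "\<And>i k. 0 \<le> s i k" "\<And>k. incseq (\<lambda>i. s i k)"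
    "\<And>k. (\<lambda>i. s i k) \<longlonglongrightarrow> a k"
  shows "incseq (\<lambda>i. lz_norm p q \<alpha> (s i))" "(\<lambda>i. lz_norm p q \<alpha> (s i)) \<longlonglongrightarrow> lz_norm p q \<alpha> a"
proof -
  have mono: "\<bar>s i k\<bar> \<le> \<bar>s j k\<bar>" if "i \<le> j" for i j k
    using that s by (simp add: incseq_def)
  show inc: "incseq (\<lambda>i. lz_norm p q \<alpha> (s i))"
    using mono by (intro monoI lz_norm_mono q)
  have "incseq (\<lambda>i n. ennreal (lz_weight p q \<alpha> n) * enn_rearrangement (s i) n)"
    using mono by (auto simp: incseq_def le_fun_def intro!: mult_left_mono enn_rearrangement_mono)
  then have "lz_norm p q \<alpha> a = (SUP i. lz_norm p q \<alpha> (s i))"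
    unfolding lz_norm_eq enn_rearrangement_SUP[OF s]
    by (simp add: SUP_mult_left_ennreal lq_enn_SUP[OF q])
  then show "(\<lambda>i. lz_norm p q \<alpha> (s i)) \<longlonglongrightarrow> lz_norm p q \<alpha> a"
    using LIMSEQ_SUP[OF inc] by simp
qed

lemma lz_norm_indicator_finite:
  assumes "0 < q" "finite E"
  shows "lz_norm p q \<alpha> (indicator E) < \<infinity>"
  unfolding lz_norm_eq
proof (rule lq_enn_finite_support[OF assms(1), where N = "card E"])
  fix n
  \<comment> \<open>Level 1 is admissible for every \<open>n\<close>, which bounds the rearrangement
    by 1.\<close>
  have "{k. \<bar>indicator E k :: ereal\<bar> > ereal 1} = {}"
    by (auto simp: indicator_def)
  then have "enn_rearrangement (indicator E) n \<le> ennreal 1"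
    by (subst enn_rearrangement_le_iff) (auto simp: distribution_fun_def)
  then have "enn_rearrangement (indicator E) n < \<infinity>"
    by (simp add: le_less_trans)
  then show "ennreal (lz_weight p q \<alpha> n) * enn_rearrangement (indicator E) n < \<infinity>"
    by (simp add: ennreal_mult_less_top)
next
  fix n assume n: "card E \<le> n"
  \<comment> \<open>With indices from 0, level 0 becomes admissible exactly from
    \<open>n = card E\<close> on, so the rearrangement vanishes there.\<close>
  have "{k. \<bar>indicator E k :: ereal\<bar> > ereal 0} = E"
    by (auto simp: indicator_def)
  then have "distribution_fun (indicator E) 0 = of_nat (card E)"
    using assms(2) by (simp add: distribution_fun_def)
  then have "enn_rearrangement (indicator E) n \<le> ennreal 0"
    using n by (subst enn_rearrangement_le_iff) auto
  then show "ennreal (lz_weight p q \<alpha> n) * enn_rearrangement (indicator E) n = 0"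
    by simp
qed

text \<open>The Galois relation determines the rearrangement from the distribution function at
  nonnegative levels.\<close>

lemma lz_norm_rearrangement_invariant:
  assumes "\<forall>t\<ge>0. distribution_fun a t = distribution_fun b t"
  shows "lz_norm p q \<alpha> a = lz_norm p q \<alpha> b"
proof -
  have "enn_rearrangement a n = enn_rearrangement b n" for n
    using assms by (intro antisym ennreal_le_by_reals) (auto simp: less_enn_rearrangement_iff)
  then show ?thesis
    by (simp add: lz_norm_eq)
qed

lemma finite_if_emeasure_counting_finite: "emeasure counting E < \<infinity> \<Longrightarrow> finite E"
  by (rule ccontr) simp

theorem proposition5p4:
  fixes p q :: ennreal and \<alpha> :: real
  assumes "0 < p" and "0 < q"
  shows "ri_quasi_banach_sequence_space (lz_space p q \<alpha>) (lz_norm p q \<alpha>)"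
proof
  note q = \<open>0 < q\<close>
  show "lz_space p q \<alpha> = {a. lz_norm p q \<alpha> a < \<infinity>}"
    by (simp add: lz_space_def)
  show "lz_norm p q \<alpha> a = 0 \<longleftrightarrow> (\<forall>k. a k = 0)" for a
    by (rule lz_norm_eq_0_iff[OF q])
  show "lz_norm p q \<alpha> (\<lambda>k. ereal c * a k) = ennreal \<bar>c\<bar> * lz_norm p q \<alpha> a" for c a
    by (rule lz_norm_cmult[OF q])
  show "\<exists>C :: real. C > 0 \<and> (\<forall>a b. sum_defined a b \<longrightarrow>
      lz_norm p q \<alpha> (\<lambda>k. a k + b k) \<le> ennreal C * (lz_norm p q \<alpha> a + lz_norm p q \<alpha> b))"
    using lz_norm_triangle[OF q] by blast
  show "lz_norm p q \<alpha> a = lz_norm p q \<alpha> (\<lambda>k. \<bar>a k\<bar>)" for a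
    \<comment> \<open>Taking absolute values leaves the distribution function unchanged.\<close>
    by (rule lz_norm_rearrangement_invariant) (simp add: distribution_fun_def)
  show "lz_norm p q \<alpha> a \<le> lz_norm p q \<alpha> b" if "\<forall>k. 0 \<le> a k \<and> a k \<le> b k" for a b
  proof (rule lz_norm_mono[OF q])
    fix k
    show "\<bar>a k\<bar> \<le> \<bar>b k\<bar>"
      using that[rule_format, of k] order_trans[of 0 "a k" "b k"] by simp
  qed
  show "incseq (\<lambda>i. lz_norm p q \<alpha> (s i)) \<and> (\<lambda>i. lz_norm p q \<alpha> (s i)) \<longlonglongrightarrow> lz_norm p q \<alpha> a"
    if "\<forall>k. (\<forall>i. 0 \<le> s i k) \<and> incseq (\<lambda>i. s i k) \<and> (\<lambda>i. s i k) \<longlonglongrightarrow> a k"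
    for s :: "nat \<Rightarrow> eseq" and a
    using that by (intro conjI lz_norm_monotone_convergence q) auto
  show "lz_norm p q \<alpha> (indicator E) < \<infinity>" if "emeasure counting E < \<infinity>" for E
    by (rule lz_norm_indicator_finite[OF q finite_if_emeasure_counting_finite[OF that]])
  show "\<exists>C :: real. C \<ge> 0 \<and>
      (\<forall>a\<in>lz_space p q \<alpha>. (\<Sum>n\<in>E. e2ennreal \<bar>a n\<bar>) \<le> ennreal C * lz_norm p q \<alpha> a)"
    if "emeasure counting E < \<infinity>" for E
  \<comment> \<open>Each of the \<open>card E\<close> summands is at most the norm.\<close>
  proof (intro exI[of _ "real (card E)"] conjI ballI)
    fix a
    have "(\<Sum>n\<in>E. e2ennreal \<bar>a n\<bar>) \<le> of_nat (card E) * lz_norm p q \<alpha> a"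
      by (intro sum_bounded_above e2ennreal_abs_le_lz_norm[OF q])
    then show "(\<Sum>n\<in>E. e2ennreal \<bar>a n\<bar>) \<le> ennreal (real (card E)) * lz_norm p q \<alpha> a"
      by (simp add: ennreal_of_nat_eq_real_of_nat)
  qed simp
  show "lz_norm p q \<alpha> a = lz_norm p q \<alpha> b"
    if "\<forall>t\<ge>0. distribution_fun a t = distribution_fun b t" for a b
    using that by (rule lz_norm_rearrangement_invariant)
qed

end
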